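(* Let $\beta$ be a real number with $\beta\ge e^2+e^{-1}-e+1$ $(\approx 6.03865)$. If $p\in\mathcal{H}_1$ satisfies $$p^2(z)+p(z)-1+\beta zp'(z)\prec e^z,$$ then $p(z)\prec e^z$.
   Context: $\mathbb{D}=\{z\in\mathbb{C}:|z|<1\}$. $\mathcal{H}_1$ is the class of analytic functions on $\mathbb{D}$ of the form $p(z)=1+a_1z+a_2z^2+\cdots$. $p^2(z)$ means $(p(z))^2$. For functions $F,G$ analytic in $\mathbb{D}$, $F\prec G$ (F is subordinate to G) means there is an analytic $w:\mathbb{D}\to\mathbb{C}$ with $w(0)=0$, $|w(z)|<1$ and $F(z)=G(w(z))$ for all $z\in\mathbb{D}$. *)

theory Defs
  imports "HOL-Complex_Analysis.Complex_Analysis"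
begin

abbreviation unit_disc :: "complex set" where
  "unit_disc \<equiv> ball 0 1"

definition class_H1 :: "(complex \<Rightarrow> complex) set" where
  "class_H1 = {p. p analytic_on unit_disc \<and>
     (\<exists>a. a 0 = 1 \<and> (\<forall>z\<in>unit_disc. (\<lambda>n. a n * z ^ n) sums p z))}"

text \<open>Values of \<open>F\<close> and \<open>G\<close> outside the disc play no role. Analyticity of \<open>F\<close> and \<open>G\<close> is
  a convention on the arguments, not part of the relation.\<close>

definition subordinate :: "(complex \<Rightarrow> complex) \<Rightarrow> (complex \<Rightarrow> complex) \<Rightarrow> bool"
    (infix \<open>\<prec>\<^sub>s\<close> 50) where
  "F \<prec>\<^sub>s G \<longleftrightarrow> (\<exists>w. w analytic_on unit_disc \<and> w 0 = 0 \<and>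
     (\<forall>z\<in>unit_disc. norm (w z) < 1 \<and> F z = G (w z)))"

end

theory Submission
  imports Defs
begin

text \<open>
  If \<open>p\<close> leaves \<open>exp ` unit_disc\<close>, take an exit point \<open>z\<^sub>0\<close> of least modulus and put
  \<open>w = Ln \<circ> p\<close>, so that \<open>\<zeta> = w z\<^sub>0\<close> is unimodular. Jack's lemma gives
  \<open>Re (cnj \<zeta> * (z\<^sub>0 * w' z\<^sub>0)) \<ge> 1\<close>. The left-hand side of the hypothesis, divided by
  \<open>p z\<^sub>0 = exp \<zeta>\<close>, equals \<open>exp \<zeta> + 1 - exp (-\<zeta>) + \<beta> * (z\<^sub>0 * w' z\<^sub>0)\<close>; its component in
  the direction of \<open>\<zeta>\<close> is at least \<open>exp (1 - Re \<zeta>)\<close>. Hence the left-hand side has modulus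
  at least \<open>exp 1\<close> at \<open>z\<^sub>0\<close> and lies outside \<open>exp ` unit_disc\<close>.
\<close>

section \<open>Real and complex estimates for sin, cos, sinh and exp\<close>

lemma one_minus_half_sq_le_cos: "1 - s\<^sup>2 / 2 \<le> cos (s::real)"
proof -
  have "(sin (s / 2))\<^sup>2 \<le> (s / 2)\<^sup>2"
    using abs_sin_x_le_abs_x[of "s / 2"] by (simp only: abs_le_square_iff)
  moreover have "cos s = 1 - 2 * (sin (s / 2))\<^sup>2"
    using cos_double_sin[of "s / 2"] by simp
  ultimately show ?thesis by (simp add: power2_eq_square)
qed

text \<open>On [0, 1] the function \<open>sin x - x / 2\<close> increases, because
  \<open>cos x \<ge> 1 - x\<^sup>2 / 2 \<ge> 1 / 2\<close>; negative \<open>s\<close> follows by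
  evenness.\<close>

lemma half_sq_le_mult_sin:
  fixes s :: real
  assumes "\<bar>s\<bar> \<le> 1"
  shows "s\<^sup>2 / 2 \<le> s * sin s"
proof -
  have nonneg: "u\<^sup>2 / 2 \<le> u * sin u" if u: "0 \<le> u" "u \<le> 1" for u :: real
  proof -
    have "(\<lambda>x. sin x - x / 2) 0 \<le> (\<lambda>x. sin x - x / 2) u"
    proof (rule DERIV_nonneg_imp_nondecreasing[OF u(1)])
      fix x :: real assume x: "0 \<le> x" "x \<le> u"
      have "((\<lambda>x. sin x - x / 2) has_real_derivative cos x - 1 / 2) (at x)"
        by (auto intro!: derivative_eq_intros)
      moreover have "x\<^sup>2 \<le> 1" using x u by (simp add: power_le_one)
      then have "0 \<le> cos x - 1 / 2" using one_minus_half_sq_le_cos[of x] by simp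
      ultimately show "\<exists>y. ((\<lambda>x. sin x - x / 2) has_real_derivative y) (at x) \<and> 0 \<le> y"
        by blast
    qed
    then have "u * (u / 2) \<le> u * sin u" using u by (intro mult_left_mono) auto
    then show ?thesis by (simp add: power2_eq_square)
  qed
  show ?thesis
    using nonneg[of s] nonneg[of "- s"] assms by (cases "0 \<le> s") auto
qed

text \<open>The left-hand side is the tangent line of \<open>t * sinh t\<close> at
  \<open>t = 1\<close>, taken at \<open>\<bar>c\<bar>\<close>: its slope is
  \<open>sinh 1 + cosh 1 = exp 1\<close>. On [0, 1] the slope of \<open>t * sinh t\<close> stays
  below \<open>sinh t + cosh t = exp t \<le> exp 1\<close>.\<close>

lemma mult_sinh_ge_tangent:
  fixes c :: real
  assumes "\<bar>c\<bar> \<le> 1"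
  shows "sinh 1 - exp 1 * (1 - \<bar>c\<bar>) \<le> c * sinh c"
proof -
  let ?g = "\<lambda>t::real. t * sinh t - exp 1 * t"
  have "?g 1 \<le> ?g \<bar>c\<bar>"
  proof (rule DERIV_nonpos_imp_nonincreasing[OF assms])
    fix t :: real assume t: "\<bar>c\<bar> \<le> t" "t \<le> 1"
    have "(?g has_real_derivative sinh t + t * cosh t - exp 1) (at t)"
      by (auto intro!: derivative_eq_intros)
    moreover have "t * cosh t \<le> 1 * cosh t" using t by (intro mult_right_mono) auto
    then have "sinh t + t * cosh t \<le> exp t" by (simp add: sinh_plus_cosh[symmetric])
    then have "sinh t + t * cosh t - exp 1 \<le> 0" using t
      by (smt (verit) exp_le_cancel_iff)
    ultimately show "\<exists>y. (?g has_real_derivative y) (at t) \<and> y \<le> 0" by blast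
  qed
  moreover have "\<bar>c\<bar> * sinh \<bar>c\<bar> = c * sinh c" by (cases "0 \<le> c") auto
  ultimately show ?thesis by (simp add: algebra_simps)
qed

text \<open>For \<zeta> = c + i s the real part is
  \<open>c * sinh c * cos s + s * sin s * cosh c\<close>. Replacing \<open>cos s\<close> by 1 costs
  at most \<open>s\<^sup>2 / 2 * (c * sinh c)\<close>, which the second summand covers since
  \<open>c * sinh c \<le> cosh c\<close>. What remains is \<open>c * sinh c\<close>, bounded by its
  tangent.\<close>

lemma Re_cnj_mult_sinh_ge:
  fixes \<zeta> :: complex
  assumes "norm \<zeta> = 1"
  shows "sinh 1 - exp 1 * (1 - \<bar>Re \<zeta>\<bar>) \<le> Re (cnj \<zeta> * sinh \<zeta>)"
proof -
  define c s where "c = Re \<zeta>" and "s = Im \<zeta>"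
  have cs: "c\<^sup>2 + s\<^sup>2 = 1" using assms cmod_power2[of \<zeta>] by (simp add: c_def s_def)
  have c1: "\<bar>c\<bar> \<le> 1" and s1: "\<bar>s\<bar> \<le> 1"
    using abs_Re_le_cmod[of \<zeta>] abs_Im_le_cmod[of \<zeta>] assms by (auto simp: c_def s_def)
  have Re_eq: "Re (cnj \<zeta> * sinh \<zeta>) = c * sinh c * cos s + s * sin s * cosh c"
    by (simp add: sinh_def cosh_def Re_exp Im_exp c_def s_def field_simps)
  have nonneg: "0 \<le> c * sinh c" by (auto simp: zero_le_mult_iff)
  have "c * sinh c = \<bar>c\<bar> * \<bar>sinh c\<bar>" using nonneg by (simp flip: abs_mult)
  also have "\<dots> \<le> 1 * cosh c"
    using c1 sinh_le_cosh_real[of "\<bar>c\<bar>"] by (intro mult_mono) auto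
  finally have "s\<^sup>2 / 2 * (c * sinh c) \<le> s\<^sup>2 / 2 * cosh c"
    by (intro mult_left_mono) auto
  also have "\<dots> \<le> s * sin s * cosh c"
    using half_sq_le_mult_sin[OF s1] by (intro mult_right_mono) auto
  finally have "s\<^sup>2 / 2 * (c * sinh c) \<le> s * sin s * cosh c" .
  moreover have "c * sinh c * (1 - s\<^sup>2 / 2) \<le> c * sinh c * cos s"
    using nonneg one_minus_half_sq_le_cos by (intro mult_left_mono) auto
  ultimately have "c * sinh c \<le> Re (cnj \<zeta> * sinh \<zeta>)"
    unfolding Re_eq by (simp add: algebra_simps)
  with mult_sinh_ge_tangent[OF c1] show ?thesis by (simp add: c_def)
qed

text \<open>Completing the square gives \<open>(exp 1 - 3 / 2)\<^sup>2 \<ge> 5 / 4\<close>. The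
  margin is small: e must exceed about 2.618, and squaring the Taylor bound \<open>13 / 8\<close>
  for \<open>exp (1 / 2)\<close> gives about 2.64.\<close>

lemma three_e_le: "3 * exp 1 \<le> exp 2 + (1::real)"
proof -
  define h :: real where "h = exp (1 / 2)"
  have "1 + 1 / 2 + (1 / 2)\<^sup>2 / 2 \<le> h"
    unfolding h_def by (rule exp_lower_Taylor_quadratic) simp
  then have "(13 / 8)\<^sup>2 \<le> h\<^sup>2" by (intro power_mono) (auto simp: power2_eq_square)
  moreover have h2: "h\<^sup>2 = exp 1" by (simp add: h_def power2_eq_square flip: exp_add)
  ultimately have "(exp 1 - 3 / 2 :: real) \<ge> 9 / 8" by (simp add: power2_eq_square)
  then have "(exp 1 - 3 / 2 :: real)\<^sup>2 \<ge> (9 / 8)\<^sup>2" by (intro power_mono) auto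
  moreover have "exp 2 = (exp 1 :: real)\<^sup>2" by (simp add: power2_eq_square flip: exp_add)
  ultimately show ?thesis by (simp add: power2_eq_square algebra_simps)
qed

text \<open>For \<open>c \<le> 0\<close>, exp lies below its chord over [1, 2], and the chord's
  slope is at least \<open>2 * exp 1 - 1\<close> by \<open>three_e_le\<close>; equality holds at
  \<open>c = -1\<close>. For \<open>c > 0\<close> the crude bound
  \<open>exp (1 - c) \<le> exp 1\<close> is enough.\<close>

lemma exp_one_minus_le:
  fixes c :: real
  assumes "\<bar>c\<bar> \<le> 1"
  shows "exp (1 - c) \<le> exp 2 + 1 + c - 2 * exp 1 * (1 - \<bar>c\<bar>)"
proof (cases "c \<le> 0")
  case True
  have "exp ((1 - (- c)) *\<^sub>R 1 + (- c) *\<^sub>R 2) \<le> (1 - (- c)) * exp 1 + (- c) * exp (2::real)"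
    using convex_onD[OF exp_convex, of "- c" "1::real" 2] assms True by simp
  then have "exp (1 - c) \<le> exp 2 - (exp 2 - exp 1) * (1 + c)"
    by (simp add: algebra_simps)
  moreover have "(2 * exp 1 - 1) * (1 + c) \<le> (exp 2 - exp 1) * (1 + c)"
    using three_e_le assms by (intro mult_right_mono) auto
  ultimately show ?thesis using True by (simp add: algebra_simps)
next
  case False
  then have "exp (1 - c) \<le> exp 1" and "0 \<le> exp 1 * c" by auto
  moreover have "2 * exp 1 * (1 - \<bar>c\<bar>) = 2 * exp 1 - 2 * (exp 1 * c)"
    using False by (simp add: algebra_simps)
  ultimately show ?thesis using False three_e_le by linarith
qed

text \<open>Jack's lemma.\<close>

lemma Re_radial_deriv_ge_1:
  fixes f :: "complex \<Rightarrow> complex"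
  assumes hol: "f holomorphic_on ball 0 (norm z0)"
    and f0: "f 0 = 0"
    and bound: "\<And>z. norm z < norm z0 \<Longrightarrow> norm (f z) < 1"
    and unit: "norm (f z0) = 1"
    and der: "(f has_field_derivative D) (at z0)"
  shows "1 \<le> Re (cnj (f z0) * (z0 * D))"
proof (rule ccontr)
  assume neg: "\<not> ?thesis"
  have "z0 \<noteq> 0" using unit f0 by auto
  define r where "r = norm z0"
  have r: "r > 0" using \<open>z0 \<noteq> 0\<close> by (simp add: r_def)
  have scaled: "norm (of_real r * z) < norm z0" if "norm z < 1" for z :: complex
    using that r by (simp add: norm_mult r_def)
  \<comment> \<open>The Schwarz lemma for \<open>f (r * z)\<close> on the unit disc, at a point of
    modulus \<open>t\<close>.\<close>
  have Schwarz: "norm (f (of_real t * z0)) \<le> t" if t: "0 \<le> t" "t < 1" for t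
  proof -
    have "norm ((\<lambda>z. f (of_real r * z)) (of_real t * z0 / of_real r))
          \<le> norm (of_real t * z0 / of_real r)"
    proof (rule Schwarz_Lemma(1))
      show "(\<lambda>z. f (of_real r * z)) holomorphic_on ball 0 1"
        by (rule holomorphic_on_compose_gen[OF _ hol, unfolded o_def])
           (auto intro!: holomorphic_intros scaled)
      show "norm (f (of_real r * z)) < 1" if "norm z < 1" for z
        using bound scaled that by blast
      show "norm (of_real t * z0 / of_real r) < 1"
        using t r by (simp add: norm_mult norm_divide r_def)
    qed (simp add: f0)
    then show ?thesis using r t by (simp add: norm_mult norm_divide r_def)
  qed
  \<comment> \<open>\<open>g\<close> vanishes at 1 and is nonpositive on [0, 1) by the Schwarz
    bound; a negative derivative at 1 would make it positive just to the left of 1.\<close>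
  define g where "g = (\<lambda>t. Re (cnj (f z0) * f (of_real t * z0)) - t)"
  have "((\<lambda>t. f (of_real t * z0)) has_vector_derivative (z0 * D)) (at 1)"
    using der
    by (intro field_vector_diff_chain_at[of "\<lambda>t. of_real t * z0" z0 1 f D, unfolded o_def])
       (auto intro!: derivative_eq_intros simp: has_vector_derivative_def scaleR_conv_of_real)
  then have "((\<lambda>t. cnj (f z0) * f (of_real t * z0)) has_vector_derivative cnj (f z0) * (z0 * D)) (at 1)"
    by (rule has_vector_derivative_mult_right)
  then have "((\<lambda>t. Re (cnj (f z0) * f (of_real t * z0))) has_real_derivative
       Re (cnj (f z0) * (z0 * D))) (at 1)"
    unfolding has_real_derivative_iff_has_vector_derivative
    by (rule bounded_linear.has_vector_derivative[OF bounded_linear_Re])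
  then have "(g has_real_derivative Re (cnj (f z0) * (z0 * D)) - 1) (at 1)"
    unfolding g_def by (intro DERIV_diff DERIV_ident)
  from DERIV_neg_dec_left[OF this] neg obtain d
    where d: "d > 0" "\<And>h. h > 0 \<Longrightarrow> h < d \<Longrightarrow> g 1 < g (1 - h)" by auto
  \<comment> \<open>The minimum keeps \<open>1 - t\<close> below \<open>d\<close> and
    \<open>t\<close> nonnegative, as the Schwarz bound requires.\<close>
  define t where "t = 1 - min (d / 2) (1 / 2)"
  have t: "0 \<le> t" "t < 1" and "g 1 < g t"
    using d by (auto simp: t_def)
  moreover have "g 1 = 0"
    using unit cmod_power2[of "f z0"] by (simp add: g_def power2_eq_square)
  moreover have "Re (cnj (f z0) * f (of_real t * z0)) \<le> norm (cnj (f z0) * f (of_real t * z0))"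
    by (rule complex_Re_le_cmod)
  then have "g t \<le> 0" using Schwarz[OF t] unit by (simp add: g_def norm_mult)
  ultimately show False by simp
qed

section \<open>The image of the disc under exp, and the points where a function leaves it\<close>

lemma exp_unit_cball_notin_nonpos_Reals:
  fixes z :: complex
  assumes "norm z \<le> 1"
  shows "exp z \<notin> \<real>\<^sub>\<le>\<^sub>0"
proof -
  have "\<bar>Im z\<bar> < pi / 2" using assms abs_Im_le_cmod[of z] pi_gt3 by linarith
  then have "0 < Re (exp z)" by (auto simp: Re_exp intro!: mult_pos_pos cos_gt_zero_pi)
  then show ?thesis by (auto simp: complex_nonpos_Reals_iff)
qed

lemma Ln_exp_unit_cball:
  fixes z :: complex
  assumes "norm z \<le> 1"
  shows "Ln (exp z) = z"
  using assms abs_Im_le_cmod[of z] pi_gt3 by (intro Ln_exp) linarith+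

text \<open>Membership in the image becomes a condition on \<open>Ln\<close>, which inverts exp on
  the closed disc as imaginary parts stay below pi. Openness of the image and holomorphy of
  \<open>Ln (p z)\<close> can be read off from this form.\<close>

lemma exp_unit_disc_eq: "exp ` unit_disc = {v. v \<notin> \<real>\<^sub>\<le>\<^sub>0 \<and> norm (Ln v) < 1}"
proof (intro equalityI subsetI)
  fix v :: complex assume "v \<in> {v. v \<notin> \<real>\<^sub>\<le>\<^sub>0 \<and> norm (Ln v) < 1}"
  then have "exp (Ln v) = v" "Ln v \<in> unit_disc" by (auto intro: exp_Ln)
  then show "v \<in> exp ` unit_disc" by (metis imageI)
qed (auto simp: exp_unit_cball_notin_nonpos_Reals Ln_exp_unit_cball)

lemma open_exp_unit_disc: "open (exp ` unit_disc :: complex set)"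
proof -
  have "open (- \<real>\<^sub>\<le>\<^sub>0 \<inter> Ln -` unit_disc)"
    by (intro continuous_open_preimage continuous_on_Ln) auto
  also have "- \<real>\<^sub>\<le>\<^sub>0 \<inter> Ln -` unit_disc = exp ` unit_disc"
    by (auto simp: exp_unit_disc_eq)
  finally show ?thesis .
qed

text \<open>Within the closed ball through \<open>z1\<close>, the points sent outside the open set
  \<open>U\<close> form a compact nonempty set, so the norm attains its minimum there.\<close>

lemma first_exit_point:
  fixes p :: "complex \<Rightarrow> 'a::topological_space"
  assumes cont: "continuous_on (ball 0 R) p" and "open U"
    and out: "norm z1 < R" "p z1 \<notin> U"
  obtains z0 where "norm z0 < R" "p z0 \<notin> U" "\<And>z. norm z < norm z0 \<Longrightarrow> p z \<in> U"
proof -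
  define S where "S = {z \<in> cball 0 (norm z1). p z \<in> - U}"
  have "continuous_on (cball 0 (norm z1)) p"
    using cont by (rule continuous_on_subset) (use out in auto)
  then have "closed S"
    using continuous_closed_preimage[of "cball 0 (norm z1)" p "- U"] \<open>open U\<close>
    by (auto simp: S_def vimage_def Int_def)
  moreover have "bounded S" by (rule bounded_subset[OF bounded_cball[of 0 "norm z1"]]) (auto simp: S_def)
  ultimately have "compact S" by (simp add: compact_eq_bounded_closed)
  moreover have "z1 \<in> S" using out by (simp add: S_def)
  ultimately obtain z0 where z0: "z0 \<in> S" "\<And>z. z \<in> S \<Longrightarrow> norm z0 \<le> norm z"
    using continuous_attains_inf[of S norm] by (metis continuous_on_norm_id empty_iff)
  have "p z \<in> U" if "norm z < norm z0" for z
    using z0(2)[of z] z0(1) that by (force simp: S_def)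
  moreover have "norm z0 < R" "p z0 \<notin> U" using z0(1) out by (auto simp: S_def)
  ultimately show thesis by (rule that[rotated 2])
qed

text \<open>\<open>p z0\<close> is a limit of values in the image of the closed disc, which is
  compact and hence closed. So \<open>p z0 = exp \<zeta>\<close> with \<zeta> in the closed disc,
  and the open disc is excluded.\<close>

lemma exit_point_unimodular:
  fixes p :: "complex \<Rightarrow> complex"
  assumes cont: "isCont p z0" and "z0 \<noteq> 0" "p z0 \<notin> exp ` unit_disc"
    and inside: "\<And>z. norm z < norm z0 \<Longrightarrow> p z \<in> exp ` unit_disc"
  obtains \<zeta> :: complex where "norm \<zeta> = 1" "p z0 = exp \<zeta>"
proof -
  have "compact (exp ` cball (0::complex) 1)"
    by (intro compact_continuous_image continuous_intros) auto
  then have "closed (exp ` cball (0::complex) 1)" by (rule compact_imp_closed)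
  moreover have "(p \<longlongrightarrow> p z0) (at z0 within ball 0 (norm z0))"
    using cont by (simp add: isCont_def tendsto_within_subset[where S = UNIV])
  moreover have "at z0 within ball 0 (norm z0) \<noteq> bot"
    using \<open>z0 \<noteq> 0\<close> by (subst at_within_eq_bot_iff)
      (simp flip: islimpt_in_closure add: trivial_limit_within islimpt_ball)
  moreover have "\<forall>\<^sub>F z in at z0 within ball 0 (norm z0). p z \<in> exp ` cball 0 1"
    unfolding eventually_at_filter
    by (intro always_eventually) (metis inside ball_subset_cball image_mono mem_ball_0 subsetD)
  ultimately have "p z0 \<in> exp ` cball 0 1" by (metis Lim_in_closed_set)
  then obtain \<zeta> where "norm \<zeta> \<le> 1" "p z0 = exp \<zeta>" by auto
  with assms(3) that show thesis by force
qed

section \<open>The lower bound at an exit point and the subordination\<close>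

lemma Re_cnj_quotient_ge:
  fixes \<zeta> \<eta> :: complex and \<beta> :: real
  assumes beta: "\<beta> \<ge> exp 2 + exp (- 1) - exp 1 + 1"
    and unit: "norm \<zeta> = 1" and Re_ge: "1 \<le> Re (cnj \<zeta> * \<eta>)"
  shows "exp (1 - Re \<zeta>) \<le> Re (cnj \<zeta> * (exp \<zeta> + 1 - exp (- \<zeta>) + of_real \<beta> * \<eta>))"
proof -
  have "0 \<le> exp 2 - 3 * exp 1 + (1::real)" using three_e_le by simp
  then have "0 \<le> \<beta>" using beta exp_gt_zero[of "1::real"] exp_gt_zero[of "-1::real"] by linarith
  then have beta_le: "\<beta> * 1 \<le> \<beta> * Re (cnj \<zeta> * \<eta>)" using Re_ge by (intro mult_left_mono)
  have "cnj \<zeta> * (exp \<zeta> + 1 - exp (- \<zeta>) + of_real \<beta> * \<eta>)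
      = cnj \<zeta> + of_real 2 * (cnj \<zeta> * sinh \<zeta>) + of_real \<beta> * (cnj \<zeta> * \<eta>)"
    by (simp add: sinh_def algebra_simps scaleR_conv_of_real)
  moreover have "Re (cnj \<zeta> + of_real 2 * u + of_real \<beta> * v) = Re \<zeta> + 2 * Re u + \<beta> * Re v"
    for u v by simp
  ultimately have "Re (cnj \<zeta> * (exp \<zeta> + 1 - exp (- \<zeta>) + of_real \<beta> * \<eta>))
      = Re \<zeta> + 2 * Re (cnj \<zeta> * sinh \<zeta>) + \<beta> * Re (cnj \<zeta> * \<eta>)"
    by metis
  \<comment> \<open>The lower bounds for the three summands now add up to the right-hand side of
    \<open>exp_one_minus_le\<close>. For \<beta> equal to its lower bound, the resulting estimate is
    an equality at \<zeta> = \<eta> = -1.\<close>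
  moreover have "2 * sinh 1 = exp 1 - exp (- 1 :: real)" by (simp add: sinh_def)
  ultimately show ?thesis
    using exp_one_minus_le[of "Re \<zeta>"] Re_cnj_mult_sinh_ge[OF unit] abs_Re_le_cmod[of \<zeta>] beta unit
      beta_le
    by (simp add: algebra_simps)
qed

theorem theorem4p9:
  fixes \<beta> :: real and p :: "complex \<Rightarrow> complex"
  assumes "\<beta> \<ge> exp 2 + exp (- 1) - exp 1 + 1"
    and "p \<in> class_H1"
    and "(\<lambda>z. (p z)\<^sup>2 + p z - 1 + complex_of_real \<beta> * z * deriv p z) \<prec>\<^sub>s exp"
  shows "p \<prec>\<^sub>s exp"
proof -
  have an: "p analytic_on unit_disc" using assms(2) by (simp add: class_H1_def)
  then have hol: "p holomorphic_on unit_disc" by (rule analytic_imp_holomorphic)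
  have p0: "p 0 = 1"
  proof -
    obtain a where a: "a 0 = 1" "\<forall>z\<in>unit_disc. (\<lambda>n. a n * z ^ n) sums p z"
      using assms(2) by (auto simp: class_H1_def)
    then have "(\<lambda>n. a n * 0 ^ n) sums p 0" by (metis centre_in_ball zero_less_one)
    then show ?thesis using a(1) by simp
  qed
  have range: "p z \<in> exp ` unit_disc" if "norm z < 1" for z
  proof (rule ccontr)
    assume "p z \<notin> exp ` unit_disc"
    with that obtain z0 where z0: "norm z0 < 1" "p z0 \<notin> exp ` unit_disc"
      and inside: "\<And>z. norm z < norm z0 \<Longrightarrow> p z \<in> exp ` unit_disc"
      using first_exit_point[OF holomorphic_on_imp_continuous_on[OF hol] open_exp_unit_disc]
      by metis
    have dp: "(p has_field_derivative deriv p z0) (at z0)"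
      using z0 holomorphic_derivI[OF hol, of z0] by simp
    have "p 0 \<in> exp ` unit_disc" using p0 by (force intro: image_eqI[of _ _ 0])
    with z0 have "z0 \<noteq> 0" by auto
    then obtain \<zeta> where \<zeta>: "norm \<zeta> = 1" "p z0 = exp \<zeta>"
      using exit_point_unimodular[OF DERIV_isCont[OF dp] _ z0(2) inside] by metis
    then have Ln: "Ln (p z0) = \<zeta>" and slit: "p z0 \<notin> \<real>\<^sub>\<le>\<^sub>0"
      by (simp_all add: Ln_exp_unit_cball exp_unit_cball_notin_nonpos_Reals)
    \<comment> \<open>This is \<open>z0 * w' z0\<close> for \<open>w = Ln \<circ> p\<close>, as the
      logarithmic derivative of \<open>p\<close> is \<open>deriv p / p\<close>.\<close>
    define \<eta> where "\<eta> = z0 * (deriv p z0 / p z0)"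
    have "1 \<le> Re (cnj (Ln (p z0)) * (z0 * (deriv p z0 / p z0)))"
    proof (rule Re_radial_deriv_ge_1)
      have "p holomorphic_on ball 0 (norm z0)"
        using hol by (rule holomorphic_on_subset) (use z0 in auto)
      then show "(\<lambda>z. Ln (p z)) holomorphic_on ball 0 (norm z0)"
        using inside by (intro holomorphic_on_Ln') (auto simp: exp_unit_disc_eq)
      show "((\<lambda>z. Ln (p z)) has_field_derivative deriv p z0 / p z0) (at z0)"
        using dp slit by (auto intro!: derivative_eq_intros simp: field_simps)
    qed (use inside \<zeta> Ln p0 in \<open>auto simp: exp_unit_disc_eq\<close>)
    then have "1 \<le> Re (cnj \<zeta> * \<eta>)" by (simp add: Ln \<eta>_def)
    then have "exp (1 - Re \<zeta>) \<le> Re (cnj \<zeta> * (exp \<zeta> + 1 - exp (- \<zeta>) + of_real \<beta> * \<eta>))"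
      by (rule Re_cnj_quotient_ge[OF assms(1) \<zeta>(1)])
    also have "\<dots> \<le> norm (cnj \<zeta> * (exp \<zeta> + 1 - exp (- \<zeta>) + of_real \<beta> * \<eta>))"
      by (rule complex_Re_le_cmod)
    finally have quot: "exp (1 - Re \<zeta>) \<le> norm (exp \<zeta> + 1 - exp (- \<zeta>) + of_real \<beta> * \<eta>)"
      using \<zeta> by (simp add: norm_mult)
    \<comment> \<open>Multiplying back by \<open>p z0\<close>, of modulus
      \<open>exp (Re \<zeta>)\<close>, cancels the dependence on \<zeta>.\<close>
    have "exp 1 = exp (Re \<zeta>) * exp (1 - Re \<zeta>)" by (simp flip: exp_add)
    also have "\<dots> \<le> norm (exp \<zeta>) * norm (exp \<zeta> + 1 - exp (- \<zeta>) + of_real \<beta> * \<eta>)"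
      using quot by simp
    also have "\<dots> = norm (exp \<zeta> * (exp \<zeta> + 1 - exp (- \<zeta>) + of_real \<beta> * \<eta>))"
      by (simp only: norm_mult)
    also have "exp \<zeta> * (exp \<zeta> + 1 - exp (- \<zeta>) + of_real \<beta> * \<eta>)
        = (p z0)\<^sup>2 + p z0 - 1 + of_real \<beta> * z0 * deriv p z0"
      by (simp add: \<eta>_def \<zeta>(2) field_simps power2_eq_square exp_minus)
    finally have "exp 1 \<le> norm ((p z0)\<^sup>2 + p z0 - 1 + of_real \<beta> * z0 * deriv p z0)" .
    moreover obtain v where "norm v < 1"
      "(p z0)\<^sup>2 + p z0 - 1 + of_real \<beta> * z0 * deriv p z0 = exp v"
      using assms(3) z0(1) unfolding subordinate_def by (metis mem_ball_0)
    \<comment> \<open>The modulus of \<open>exp v\<close> is \<open>exp (Re v)\<close>.\<close>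
    ultimately have "1 \<le> Re v" by simp
    with \<open>norm v < 1\<close> complex_Re_le_cmod[of v] show False by simp
  qed
  show ?thesis
    unfolding subordinate_def
  proof (intro exI[of _ "\<lambda>z. Ln (p z)"] conjI ballI)
    show "(\<lambda>z. Ln (p z)) analytic_on unit_disc"
      using range hol
      by (subst analytic_on_open) (auto simp: exp_unit_disc_eq intro!: holomorphic_on_Ln')
    fix z assume "z \<in> unit_disc"
    then obtain u where "norm u < 1" "p z = exp u" using range[of z] by auto
    then show "norm (Ln (p z)) < 1" "p z = exp (Ln (p z))"
      by (simp_all add: Ln_exp_unit_cball)
  qed (simp add: p0)
qed

end
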